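(* Let $X$ be a finite set, let $\Gamma=\{A_1,\dots,A_n\}$ be an arbitrary (not necessarily spanning) graph on $X$, and let $\mathcal{M}_\Gamma$ be its canonical matrix, an $n\times n$ matrix over the ring of partials $\Pi(X)$. Then, as subsets of the symmetric group $S_X$, $$Aut(\Gamma)=\det(\mathcal{M}_\Gamma).$$
   Context: A graph on $X$ is a set $\Gamma$ of 2-element subsets (edges) of $X$; it is spanning if every point of $X$ lies in some edge. $Aut(\Gamma)=\{g\in S_X : g(A)\in\Gamma \text{ for all } A\in\Gamma\}$. A partial $\pi$ on $X$ is an injective function from a subset of $X$ to $X$; its class is $[\pi]=\{g\in S_X : g \text{ restricts to } \pi \text{ on the domain of }\pi\}$. The ring of partials $\Pi(X)$ is the power set of $S_X$, with addition the symmetric difference and multiplication the intersection ($0=\emptyset$, $1=S_X$); it is a commutative $\mathbb{F}_2$-algebra. A partial $\pi$ is identified with $[\pi]\in\Pi(X)$. Write $A_l=\{\mu_l,\nu_l\}$. The canonical matrix $\mathcal{M}_\Gamma$ is the $n\times n$ matrix with $(i,j)$ entry $\alpha^i_j\beta^i_j+\gamma^i_j\zeta^i_j$, where $\alpha^i_j,\beta^i_j,\gamma^i_j,\zeta^i_j$ are the partials with one-point domain given respectively by $\mu_i\mapsto\mu_j$, $\nu_i\mapsto\nu_j$, $\mu_i\mapsto\nu_j$, $\nu_i\mapsto\mu_j$. For an $n\times n$ matrix $(a_{i,j})$ over $\Pi(X)$, $\det((a_{i,j}))=\sum_{\rho\in \mathcal{S}_n}\prod_{i=1}^n a_{i,\rho(i)}$,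 with sum and product those of $\Pi(X)$ (no signs, since $1=-1$; the empty determinant is $1$). *)

theory Defs
  imports "HOL-Combinatorics.Permutations" "HOL-Algebra.Ring"
begin

text \<open>
  The symmetric group \<open>S\<^sub>X\<close> is rendered as \<open>{g. g permutes X}\<close>: total functions that are
  bijective on \<open>X\<close> and the identity outside \<open>X\<close>.
\<close>

definition sym_set :: "'a set \<Rightarrow> ('a \<Rightarrow> 'a) set" where
  "sym_set X = {g. g permutes X}"

definition graph_on :: "'a set \<Rightarrow> 'a set set \<Rightarrow> bool" where
  "graph_on X \<Gamma> \<longleftrightarrow> (\<forall>A\<in>\<Gamma>. A \<subseteq> X \<and> card A = 2)"

definition Aut :: "'a set \<Rightarrow> 'a set set \<Rightarrow> ('a \<Rightarrow> 'a) set" where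
  "Aut X \<Gamma> = {g \<in> sym_set X. \<forall>A\<in>\<Gamma>. g ` A \<in> \<Gamma>}"

definition is_partial :: "'a set \<Rightarrow> ('a \<rightharpoonup> 'a) \<Rightarrow> bool" where
  "is_partial X \<pi> \<longleftrightarrow> dom \<pi> \<subseteq> X \<and> ran \<pi> \<subseteq> X \<and> inj_on \<pi> (dom \<pi>)"

definition partial_class :: "'a set \<Rightarrow> ('a \<rightharpoonup> 'a) \<Rightarrow> ('a \<Rightarrow> 'a) set" where
  "partial_class X \<pi> = {g \<in> sym_set X. \<forall>x\<in>dom \<pi>. \<pi> x = Some (g x)}"

definition partials_ring :: "'a set \<Rightarrow> ('a \<Rightarrow> 'a) set ring" where
  "partials_ring X =
     \<lparr>carrier = Pow (sym_set X), mult = (\<inter>), one = sym_set X,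
      zero = {}, add = (\<lambda>P Q. (P - Q) \<union> (Q - P))\<rparr>"

text \<open>The determinant over a ring of characteristic 2, hence without signs; indices run over \<open>{1..n}\<close>.\<close>

definition unsigned_det :: "('r, 'm) ring_scheme \<Rightarrow> nat \<Rightarrow> (nat \<Rightarrow> nat \<Rightarrow> 'r) \<Rightarrow> 'r" where
  "unsigned_det R n a =
     (\<Oplus>\<^bsub>R\<^esub>\<rho>\<in>{\<rho>. \<rho> permutes {1..n}}. \<Otimes>\<^bsub>R\<^esub>i\<in>{1..n}. a i (\<rho> i))"

text \<open>
  The edges are \<open>A l = {\<mu> l, \<nu> l}\<close>; the four factors are the classes of the partials
  \<open>\<alpha>\<close>, \<open>\<beta>\<close>, \<open>\<gamma>\<close>, \<open>\<zeta>\<close>, in this order.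
\<close>

definition canonical_matrix ::
    "'a set \<Rightarrow> (nat \<Rightarrow> 'a) \<Rightarrow> (nat \<Rightarrow> 'a) \<Rightarrow> nat \<Rightarrow> nat \<Rightarrow> ('a \<Rightarrow> 'a) set" where
  "canonical_matrix X \<mu> \<nu> i j =
     partial_class X [\<mu> i \<mapsto> \<mu> j] \<otimes>\<^bsub>partials_ring X\<^esub> partial_class X [\<nu> i \<mapsto> \<nu> j]
     \<oplus>\<^bsub>partials_ring X\<^esub>
     partial_class X [\<mu> i \<mapsto> \<nu> j] \<otimes>\<^bsub>partials_ring X\<^esub> partial_class X [\<nu> i \<mapsto> \<mu> j]"

lemma is_partial_singleton: "a \<in> X \<Longrightarrow> b \<in> X \<Longrightarrow> is_partial X [a \<mapsto> b]"
  by (auto simp: is_partial_def)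

lemma partial_class_closed: "partial_class X \<pi> \<in> carrier (partials_ring X)"
  by (auto simp: partial_class_def partials_ring_def)

lemma cring_partials_ring: "cring (partials_ring X)"
proof (rule cringI)
  show "abelian_group (partials_ring X)"
  proof (rule abelian_groupI)
    fix P assume "P \<in> carrier (partials_ring X)"
    then show "\<exists>Q\<in>carrier (partials_ring X). Q \<oplus>\<^bsub>partials_ring X\<^esub> P = \<zero>\<^bsub>partials_ring X\<^esub>"
      by (intro bexI[of _ P]) (auto simp: partials_ring_def)
  qed (auto simp: partials_ring_def)
  show "comm_monoid (partials_ring X)"
    by (rule comm_monoidI) (auto simp: partials_ring_def)
qed (auto simp: partials_ring_def)

lemma partials_ring_char2: "P \<oplus>\<^bsub>partials_ring X\<^esub> P = \<zero>\<^bsub>partials_ring X\<^esub>"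
  by (simp add: partials_ring_def)

end

theory Submission
  imports Defs
begin

text \<open>
  A permutation that maps the edge \<open>A\<^sub>i\<close> onto the edge \<open>A\<^sub>j\<close> does so in exactly one of two ways, straight
  (\<open>\<mu>\<^sub>i \<mapsto> \<mu>\<^sub>j, \<nu>\<^sub>i \<mapsto> \<nu>\<^sub>j\<close>) or crossed, because the end points of \<open>A\<^sub>j\<close> differ. So the sum of two
  products that forms the \<open>(i, j)\<close> entry of the canonical matrix has disjoint summands, and the entry
  is the set of all permutations \<open>g\<close> of \<open>X\<close> with \<open>g(A\<^sub>i) = A\<^sub>j\<close> (lemma \<open>canonical_matrix_entry\<close>).

  Products being intersections, the term of the determinant that belongs to \<open>\<rho>\<close> is the set of all \<open>g\<close>
  with \<open>g(A\<^sub>i) = A\<^bsub>\<rho>(i)\<^esub>\<close> for every \<open>i\<close>. Since the edges \<open>A\<^sub>i\<close> are distinct, \<open>g\<close> determines \<open>\<rho>\<close>;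
  the terms are therefore disjoint, no cancellation modulo 2 takes place, and the determinant is their
  union. This union consists of the \<open>g\<close> that act on the indices of the edges through some
  permutation \<open>\<rho>\<close>. Every automorphism does so, since an injective map from the finite
  set \<open>\<Gamma>\<close> to itself is a bijection (lemma \<open>image_permutes_family_iff\<close>).
\<close>

lemma sym_set_inj: "g \<in> sym_set X \<Longrightarrow> inj g"
  by (simp add: sym_set_def permutes_inj)

lemma partial_class_singleton: "partial_class X [a \<mapsto> b] = {g \<in> sym_set X. g a = b}"
  by (auto simp: partial_class_def)

lemma finprod_partials_ring:
  assumes "finite I" and "\<And>i. i \<in> I \<Longrightarrow> f i \<subseteq> sym_set X"
  shows "(\<Otimes>\<^bsub>partials_ring X\<^esub>i\<in>I. f i) = {g \<in> sym_set X. \<forall>i\<in>I. g \<in> f i}"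
proof -
  interpret cring "partials_ring X" by (rule cring_partials_ring)
  show ?thesis
    using assms
  proof (induction I)
    case empty
    have "\<one>\<^bsub>partials_ring X\<^esub> = sym_set X" by (simp add: partials_ring_def)
    then show ?case by simp
  next
    case (insert i I)
    have "f i \<in> carrier (partials_ring X)" "f \<in> I \<rightarrow> carrier (partials_ring X)"
      using insert.prems by (auto simp: partials_ring_def)
    then have "(\<Otimes>\<^bsub>partials_ring X\<^esub>i\<in>insert i I. f i)
        = f i \<otimes>\<^bsub>partials_ring X\<^esub> (\<Otimes>\<^bsub>partials_ring X\<^esub>i\<in>I. f i)"
      using insert.hyps by simp
    also have "\<dots> = f i \<inter> (\<Otimes>\<^bsub>partials_ring X\<^esub>i\<in>I. f i)"
      by (simp only: partials_ring_def ring.simps monoid.simps)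
    also have "\<dots> = {g \<in> sym_set X. \<forall>j\<in>insert i I. g \<in> f j}"
      using insert by auto
    finally show ?case .
  qed
qed

text \<open>
  Disjointness makes the coefficient of each group element in the sum at most 1, so nothing cancels
  and the symmetric difference is a union.
\<close>

lemma finsum_partials_ring_disjoint:
  assumes "finite I" and "\<And>i. i \<in> I \<Longrightarrow> f i \<subseteq> sym_set X"
    and "\<And>i j. \<lbrakk>i \<in> I; j \<in> I; i \<noteq> j\<rbrakk> \<Longrightarrow> f i \<inter> f j = {}"
  shows "(\<Oplus>\<^bsub>partials_ring X\<^esub>i\<in>I. f i) = (\<Union>i\<in>I. f i)"
proof -
  interpret cring "partials_ring X" by (rule cring_partials_ring)
  show ?thesis
    using assms
  proof (induction I)
    case empty
    have "\<zero>\<^bsub>partials_ring X\<^esub> = {}" by (simp add: partials_ring_def)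
    then show ?case by simp
  next
    case (insert i I)
    let ?S = "\<Oplus>\<^bsub>partials_ring X\<^esub>i\<in>I. f i"
    have "f i \<in> carrier (partials_ring X)" "f \<in> I \<rightarrow> carrier (partials_ring X)"
      using insert.prems by (auto simp: partials_ring_def)
    then have "(\<Oplus>\<^bsub>partials_ring X\<^esub>i\<in>insert i I. f i) = f i \<oplus>\<^bsub>partials_ring X\<^esub> ?S"
      using insert.hyps by simp
    moreover have "f i \<oplus>\<^bsub>partials_ring X\<^esub> ?S = (f i - ?S) \<union> (?S - f i)"
      by (simp only: partials_ring_def ring.simps)
    moreover have "?S = (\<Union>i\<in>I. f i)"
      using insert.prems by (intro insert.IH) auto
    moreover have "f i \<inter> (\<Union>i\<in>I. f i) = {}"
      using insert.prems(2) insert.hyps by blast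
    ultimately show ?case by auto
  qed
qed

text \<open>
  Both summands of the entry send the pair \<open>(\<mu> i, \<nu> i)\<close> to an ordering of the target edge, one to
  each ordering. If \<open>\<mu> j = \<nu> j\<close>, the two orderings coincide and the summands cancel, which is
  what the hypothesis excludes.
\<close>

lemma canonical_matrix_entry:
  assumes "\<mu> j \<noteq> \<nu> j"
  shows "canonical_matrix X \<mu> \<nu> i j = {g \<in> sym_set X. g ` {\<mu> i, \<nu> i} = {\<mu> j, \<nu> j}}"
  using assms
  by (auto simp: canonical_matrix_def partial_class_singleton partials_ring_def doubleton_eq_iff)

text \<open>
  If \<open>g\<close> maps each \<open>A i\<close> to some member of the family, choosing an index for the image gives a map
  \<open>I \<rightarrow> I\<close>. It is injective because taking images under \<open>g\<close> and passing from \<open>i\<close> to \<open>A i\<close> are both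
  injective, hence bijective by finiteness of \<open>I\<close>.
\<close>

lemma image_permutes_family_iff:
  assumes "finite I" and A: "inj_on A I" and g: "inj g"
  shows "(\<forall>B\<in>A ` I. g ` B \<in> A ` I) \<longleftrightarrow> (\<exists>\<rho>. \<rho> permutes I \<and> (\<forall>i\<in>I. g ` A i = A (\<rho> i)))"
proof
  assume "\<forall>B\<in>A ` I. g ` B \<in> A ` I"
  then have "\<forall>i\<in>I. \<exists>j\<in>I. g ` A i = A j" by blast
  then obtain \<sigma> where \<sigma>: "\<And>i. i \<in> I \<Longrightarrow> \<sigma> i \<in> I" "\<And>i. i \<in> I \<Longrightarrow> g ` A i = A (\<sigma> i)"
    by metis
  \<comment> \<open>A permutation of \<open>I\<close> has to fix everything outside \<open>I\<close>, where \<open>\<sigma>\<close> is arbitrary.\<close>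
  define \<rho> where "\<rho> i = (if i \<in> I then \<sigma> i else i)" for i
  have "inj_on \<rho> I"
  proof (rule inj_onI)
    fix i j assume "i \<in> I" "j \<in> I" "\<rho> i = \<rho> j"
    then have "g ` A i = g ` A j" by (simp add: \<rho>_def \<sigma>)
    then have "A i = A j" using g by (simp add: inj_image_eq_iff)
    then show "i = j" using A \<open>i \<in> I\<close> \<open>j \<in> I\<close> by (auto dest: inj_onD)
  qed
  moreover have "\<rho> ` I \<subseteq> I" by (auto simp: \<rho>_def \<sigma>)
  ultimately have "bij_betw \<rho> I I"
    using \<open>finite I\<close> by (simp add: bij_betw_def endo_inj_surj)
  then have "\<rho> permutes I" by (rule bij_imp_permutes) (simp add: \<rho>_def)
  then show "\<exists>\<rho>. \<rho> permutes I \<and> (\<forall>i\<in>I. g ` A i = A (\<rho> i))"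
    using \<sigma> by (auto simp: \<rho>_def)
next
  assume "\<exists>\<rho>. \<rho> permutes I \<and> (\<forall>i\<in>I. g ` A i = A (\<rho> i))"
  then show "\<forall>B\<in>A ` I. g ` B \<in> A ` I" by (auto simp: permutes_in_image)
qed

theorem theorem5p1:
  fixes X :: "'a set" and \<Gamma> :: "'a set set" and n :: nat
    and A :: "nat \<Rightarrow> 'a set" and \<mu> \<nu> :: "nat \<Rightarrow> 'a"
  assumes "finite X"
    and "graph_on X \<Gamma>"
    and "bij_betw A {1..n} \<Gamma>"
    and "\<And>l. l \<in> {1..n} \<Longrightarrow> A l = {\<mu> l, \<nu> l}"
  shows "Aut X \<Gamma> = unsigned_det (partials_ring X) n (canonical_matrix X \<mu> \<nu>)"
proof -
  let ?R = "partials_ring X" and ?M = "canonical_matrix X \<mu> \<nu>" and ?I = "{1..n}"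
  let ?P = "{\<rho>. \<rho> permutes ?I}"
  define T where "T \<rho> = {g \<in> sym_set X. \<forall>i\<in>?I. g ` A i = A (\<rho> i)}" for \<rho>
  have inj: "inj_on A ?I" and \<Gamma>: "A ` ?I = \<Gamma>"
    using assms(3) by (auto simp: bij_betw_def)
  have neq: "\<mu> j \<noteq> \<nu> j" if "j \<in> ?I" for j
  proof -
    have "card (A j) = 2" using assms(2) \<Gamma> that by (auto simp: graph_on_def)
    then show ?thesis using assms(4)[OF that] by auto
  qed
  have entry: "?M i j = {g \<in> sym_set X. g ` A i = A j}" if "i \<in> ?I" "j \<in> ?I" for i j
    using canonical_matrix_entry[of \<mu> j \<nu> X i] neq[OF that(2)] assms(4) that by simp
  have summand: "(\<Otimes>\<^bsub>?R\<^esub>i\<in>?I. ?M i (\<rho> i)) = T \<rho>" if "\<rho> \<in> ?P" for \<rho>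
  proof -
    have eq: "?M i (\<rho> i) = {g \<in> sym_set X. g ` A i = A (\<rho> i)}" if "i \<in> ?I" for i
      using entry[OF that] permutes_in_image[of \<rho> ?I i] \<open>\<rho> \<in> ?P\<close> that by simp
    have "(\<Otimes>\<^bsub>?R\<^esub>i\<in>?I. ?M i (\<rho> i)) = {g \<in> sym_set X. \<forall>i\<in>?I. g \<in> ?M i (\<rho> i)}"
      by (rule finprod_partials_ring) (use eq in blast)+
    also have "\<dots> = T \<rho>" using eq unfolding T_def by blast
    finally show ?thesis .
  qed
  have disjoint: "T \<rho> \<inter> T \<sigma> = {}" if "\<rho> \<in> ?P" "\<sigma> \<in> ?P" "\<rho> \<noteq> \<sigma>" for \<rho> \<sigma>
  proof (rule ccontr)
    assume "T \<rho> \<inter> T \<sigma> \<noteq> {}"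
    then have "A (\<rho> i) = A (\<sigma> i)" if "i \<in> ?I" for i
      using that unfolding T_def by blast
    moreover have "\<rho> i \<in> ?I" "\<sigma> i \<in> ?I" if "i \<in> ?I" for i
      using \<open>\<rho> \<in> ?P\<close> \<open>\<sigma> \<in> ?P\<close> that by (simp_all only: mem_Collect_eq permutes_in_image)
    ultimately have "\<rho> i = \<sigma> i" if "i \<in> ?I" for i
      using inj that by (blast dest: inj_onD)
    moreover have "\<rho> i = \<sigma> i" if "i \<notin> ?I" for i
      using \<open>\<rho> \<in> ?P\<close> \<open>\<sigma> \<in> ?P\<close> that by (metis mem_Collect_eq permutes_not_in)
    ultimately show False using \<open>\<rho> \<noteq> \<sigma>\<close> by blast
  qed
  interpret cring ?R by (rule cring_partials_ring)
  have "unsigned_det ?R n ?M = (\<Oplus>\<^bsub>?R\<^esub>\<rho>\<in>?P. T \<rho>)"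
    unfolding unsigned_det_def
  proof (rule finsum_cong')
    show "T \<in> ?P \<rightarrow> carrier ?R" by (auto simp: T_def partials_ring_def)
    show "(\<Otimes>\<^bsub>?R\<^esub>i\<in>?I. ?M i (\<rho> i)) = T \<rho>" if "\<rho> \<in> ?P" for \<rho>
      using that by (rule summand)
  qed (rule refl)
  also have "\<dots> = (\<Union>\<rho>\<in>?P. T \<rho>)"
    by (rule finsum_partials_ring_disjoint)
      (use disjoint in \<open>auto simp: finite_permutations T_def\<close>)
  also have "\<dots> = {g \<in> sym_set X. \<exists>\<rho>. \<rho> permutes ?I \<and> (\<forall>i\<in>?I. g ` A i = A (\<rho> i))}"
    by (auto simp: T_def)
  also have "\<dots> = {g \<in> sym_set X. \<forall>B\<in>\<Gamma>. g ` B \<in> \<Gamma>}"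
    by (rule Collect_cong, rule conj_cong[OF refl])
      (simp only: \<Gamma>[symmetric] image_permutes_family_iff[OF finite_atLeastAtMost inj sym_set_inj])
  also have "\<dots> = Aut X \<Gamma>" by (simp add: Aut_def)
  finally show ?thesis by simp
qed

end
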